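(* Let $\rho>0$. For any $\widehat\Sigma,X\in\mathbb S_{++}^p$, the supremum in $$\sup_{\mathbb Q\in\mathcal P_\rho^0}\mathbb E^{\mathbb Q}\big[\langle\xi\xi^\top,X\rangle\big]$$ is attained by the normal distribution $\mathbb Q^\star=\mathcal N(0,S^\star)$ with covariance matrix $$S^\star=(\gamma^\star)^2(\gamma^\star I-X)^{-1}\widehat\Sigma(\gamma^\star I-X)^{-1},$$ where $\gamma^\star$ is the unique solution with $\gamma^\star I\succ X$ of the algebraic equation $$\rho^2-\mathrm{Tr}[\widehat\Sigma]+2\gamma^\star\,\mathrm{Tr}\big[(\gamma^\star I-X)^{-1}\widehat\Sigma\big]-(\gamma^\star)^2\,\mathrm{Tr}\big[(\gamma^\star I-X)^{-1}\widehat\Sigma(\gamma^\star I-X)^{-1}\big]=0.$$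
   Context: $\mathbb S_+^p$ ($\mathbb S_{++}^p$) is the cone of symmetric positive semidefinite (positive definite) real $p\times p$ matrices; $A\succ B$ means $A-B\in\mathbb S_{++}^p$; $\langle A,B\rangle=\mathrm{Tr}[A^\top B]$. $\mathcal N(0,\Sigma)$ denotes the (possibly degenerate) normal distribution on $\mathbb R^p$ with mean $0$ and covariance matrix $\Sigma\in\mathbb S_+^p$, and $\mathcal N_0^p$ is the family of all such zero-mean normal distributions. The type-2 Wasserstein distance between distributions $\mathbb P_1,\mathbb P_2$ on $\mathbb R^p$ with finite second moments is $\mathbb W(\mathbb P_1,\mathbb P_2)=\inf_\Pi\big(\int\|\xi_1-\xi_2\|^2\,\Pi(d\xi_1,d\xi_2)\big)^{1/2}$, where $\Pi$ ranges over all joint distributions with marginals $\mathbb P_1$ and $\mathbb P_2$ and $\|\cdot\|$ is the Euclidean norm. The ambiguity set is $\mathcal P_\rho^0=\{\mathbb Q\in\mathcal N_0^p:\mathbb W(\mathbb Q,\mathcal N(0,\widehat\Sigma))\le\rho\}$. Under $\mathbb E^{\mathbb Q}$, the random vector $\xi\in\mathbb R^p$ has distribution $\mathbb Q$. *)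

theory Defs
  imports "HOL-Probability.Probability"
begin

definition psd :: "real^'p^'p \<Rightarrow> bool" where
  "psd A \<longleftrightarrow> transpose A = A \<and> (\<forall>x. x \<bullet> (A *v x) \<ge> 0)"

definition pd :: "real^'p^'p \<Rightarrow> bool" where
  "pd A \<longleftrightarrow> transpose A = A \<and> (\<forall>x. x \<noteq> 0 \<longrightarrow> x \<bullet> (A *v x) > 0)"

definition loewner_gt :: "real^'p^'p \<Rightarrow> real^'p^'p \<Rightarrow> bool" (infix "\<succ>\<^sub>L" 50) where
  "A \<succ>\<^sub>L B \<longleftrightarrow> pd (A - B)"

definition frob_inner :: "real^'p^'p \<Rightarrow> real^'p^'p \<Rightarrow> real" where
  "frob_inner A B = trace (transpose A ** B)"

definition outer :: "real^'p \<Rightarrow> real^'p^'p" where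
  "outer x = (\<chi> i j. x $ i * x $ j)"

definition std_normal_vec :: "(real^'p) measure" where
  "std_normal_vec = density lborel (\<lambda>x. ennreal (\<Prod>i\<in>UNIV. std_normal_density (x $ i)))"

(* N(0, S), for S positive semidefinite (possibly singular): the law of A Z, where Z is
   standard normal on R^p and A A^T = S.  Such a square A exists for every positive semidefinite
   S, and by rotation invariance of Z the law does not depend on which A is chosen. *)
definition normal0 :: "real^'p^'p \<Rightarrow> (real^'p) measure" where
  "normal0 S = distr std_normal_vec borel (\<lambda>z. (SOME A :: real^'p^'p. A ** transpose A = S) *v z)"

definition normal0_family :: "(real^'p) measure set" where
  "normal0_family = {normal0 S | S. psd S}"

definition couplings ::
    "(real^'p) measure \<Rightarrow> (real^'p) measure \<Rightarrow> ((real^'p) \<times> (real^'p)) measure set" where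
  "couplings P1 P2 = {M. prob_space M \<and> sets M = sets borel \<and>
     distr M borel fst = P1 \<and> distr M borel snd = P2}"

(* Meant for Borel probability measures with finite second moments: the integrand is then
   integrable for every coupling, and the set of couplings is nonempty. *)
definition wasserstein2 :: "(real^'p) measure \<Rightarrow> (real^'p) measure \<Rightarrow> real" where
  "wasserstein2 P1 P2 =
     (INF M\<in>couplings P1 P2. sqrt (\<integral>z. (norm (fst z - snd z))\<^sup>2 \<partial>M))"

definition ambiguity :: "real \<Rightarrow> real^'p^'p \<Rightarrow> (real^'p) measure set" where
  "ambiguity \<rho> \<Sigma>h = {Q \<in> normal0_family. wasserstein2 Q (normal0 \<Sigma>h) \<le> \<rho>}"

end

theory Submission
  imports Defs
begin

text \<open>
The supremum is computed by weak duality for the transport problem, together with a coupling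
that makes it tight. Write \<open>R = (\<gamma> I - X)\<inverse>\<close>, \<open>N = \<gamma> R\<close> and \<open>A = N - I = R X\<close>, for
\<open>\<gamma> I \<succ> X\<close>. Completing the square with the positive definite matrix \<open>\<gamma> I - X\<close> gives
\<open>x \<bullet> X x \<le> \<gamma> \<parallel>x - y\<parallel>\<^sup>2 + \<gamma> (y \<bullet> A y)\<close> for all \<open>x\<close>, \<open>y\<close>
(\<open>quadratic_form_le_transport_penalty\<close>). Integrating against a coupling of \<open>Q\<close> with \<open>N(0, \<Sigma>h)\<close>
and minimizing over couplings bounds the objective at every \<open>Q\<close> of the ambiguity set by
\<open>\<gamma> \<rho>\<^sup>2 + \<gamma> Tr (A \<Sigma>h)\<close> (\<open>gauss_quadratic_form_le_wasserstein2\<close>).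

The square vanishes exactly for \<open>x = N y\<close>, so the optimal law is that of \<open>N \<xi>\<close> with
\<open>\<xi> \<sim> N(0, \<Sigma>h)\<close>, a normal law with covariance \<open>N \<Sigma>h N = S\<close>. The coupling \<open>(N \<xi>, \<xi>)\<close> costs
\<open>Tr (A \<Sigma>h A)\<close>. The left side of the algebraic equation for \<open>\<gamma>\<close> is
\<open>\<rho>\<^sup>2 - Tr (A \<Sigma>h A)\<close> (\<open>trace_resolvent_displacement\<close>); the equation says that this coupling
spends the whole budget, and then the bound is attained.

In an orthonormal eigenbasis \<open>u\<^sub>i\<close> of \<open>X\<close> with eigenvalues \<open>l\<^sub>i\<close>, the equation reads
\<open>\<Sum>\<^sub>i (l\<^sub>i / (\<gamma> - l\<^sub>i))\<^sup>2 (u\<^sub>i \<bullet> \<Sigma>h u\<^sub>i) = \<rho>\<^sup>2\<close>, whose left side decreases strictly from infinity to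
\<open>0\<close> on the half-line above the largest eigenvalue (\<open>secular_equation_unique_root\<close>).

The probabilistic input is that the standard normal law on \<open>\<real>\<^sup>p\<close> is rotation invariant, so that
the law of \<open>A Z\<close> depends only on \<open>A A\<^sup>T\<close> for invertible \<open>A\<close> (\<open>gauss_eqI\<close>), and that its second
moment matrix is the identity.
\<close>

section \<open>Rotation invariance of Lebesgue measure\<close>

lemma nn_integral_lborel_translate:
  fixes g :: "'a::euclidean_space \<Rightarrow> ennreal"
  assumes "g \<in> borel_measurable borel"
  shows "(\<integral>\<^sup>+x. g (x + c) \<partial>lborel) = (\<integral>\<^sup>+x. g x \<partial>lborel)"
proof -
  have "(\<integral>\<^sup>+x. g x \<partial>lborel) = (\<integral>\<^sup>+x. g x \<partial>distr lborel borel ((+) c))"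
    by (simp add: lborel_distr_plus)
  also have "\<dots> = (\<integral>\<^sup>+x. g (x + c) \<partial>lborel)"
    using assms by (subst nn_integral_distr) (auto simp: add.commute)
  finally show ?thesis by simp
qed

text \<open>
Let \<open>\<mu>\<close> be the image of Lebesgue measure \<open>\<lambda>\<close> under \<open>f\<close> and \<open>B\<close> the unit ball. Since \<open>\<mu>\<close> is again
translation invariant, evaluating the double integral of \<open>1\<^sub>B(y) 1\<^sub>A(x + y)\<close> over
\<open>\<mu>(dx) \<lambda>(dy)\<close> in both orders gives \<open>\<lambda>(B) \<mu>(A) = \<mu>(B) \<lambda>(A)\<close>, the uniqueness argument for Haar
measure. Here \<open>\<mu>(B) = \<lambda>(B)\<close> because \<open>f\<close> preserves the ball, and this number is positive and finite.
\<close>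
lemma lborel_distr_orthogonal:
  fixes f :: "'a::euclidean_space \<Rightarrow> 'a"
  assumes f: "orthogonal_transformation f"
  shows "distr lborel borel f = lborel"
proof (rule measure_eqI)
  show "sets (distr lborel borel f) = sets lborel" by simp
next
  fix A assume "A \<in> sets (distr lborel borel f)"
  then have [measurable]: "A \<in> sets borel" by simp
  have lin: "linear f" using f by (rule orthogonal_transformation_linear)
  have [measurable]: "f \<in> borel_measurable borel"
    using lin by (intro borel_measurable_continuous_onI linear_continuous_on)
      (simp add: linear_conv_bounded_linear)
  have surj: "f (inv f y) = y" for y
    using orthogonal_transformation_surj[OF f] by (simp add: surj_f_inv_f)
  let ?B = "ball 0 1 :: 'a set"
  let ?iB = "indicator ?B :: 'a \<Rightarrow> ennreal" and ?iA = "indicator A :: 'a \<Rightarrow> ennreal"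
  let ?v = "emeasure lborel ?B"
  have [measurable]: "?B \<in> sets borel" by (intro borel_open open_ball)
  have A: "emeasure (distr lborel borel f) A = (\<integral>\<^sup>+x. ?iA (f x) \<partial>lborel)"
    by (subst nn_integral_indicator[symmetric], simp) (subst nn_integral_distr, auto)
  have shiftA: "(\<integral>\<^sup>+x. ?iA (f x + y) \<partial>lborel) = (\<integral>\<^sup>+x. ?iA (f x) \<partial>lborel)" for y
  proof -
    have "f x + y = f (x + inv f y)" for x
      by (simp add: linear_add[OF lin] surj)
    then show ?thesis
      using nn_integral_lborel_translate[of "\<lambda>x. ?iA (f x)" "inv f y"] by simp
  qed
  have shiftB: "(\<integral>\<^sup>+x. ?iB (y - f x) \<partial>lborel) = ?v" for y
  proof -
    have "norm (y - f x) = norm (x + - inv f y)" for x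
    proof -
      have "y - f x = f (inv f y - x)" by (simp add: linear_diff[OF lin] surj)
      then show ?thesis
        by (simp add: orthogonal_transformation_norm[OF f] norm_minus_commute)
    qed
    then have "?iB (y - f x) = ?iB (x + - inv f y)" for x
      by (simp add: indicator_def)
    then have "(\<integral>\<^sup>+x. ?iB (y - f x) \<partial>lborel) = (\<integral>\<^sup>+x. ?iB (x + - inv f y) \<partial>lborel)"
      by simp
    also have "\<dots> = (\<integral>\<^sup>+x. ?iB x \<partial>lborel)"
      by (rule nn_integral_lborel_translate) measurable
    finally show ?thesis by simp
  qed
  have "?v * emeasure (distr lborel borel f) A
      = (\<integral>\<^sup>+y. ?iB y * (\<integral>\<^sup>+x. ?iA (f x + y) \<partial>lborel) \<partial>lborel)"
    by (simp add: shiftA A nn_integral_multc)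
  also have "\<dots> = (\<integral>\<^sup>+y. (\<integral>\<^sup>+x. ?iB y * ?iA (f x + y) \<partial>lborel) \<partial>lborel)"
    by (subst nn_integral_cmult) auto
  also have "\<dots> = (\<integral>\<^sup>+x. (\<integral>\<^sup>+y. ?iB y * ?iA (f x + y) \<partial>lborel) \<partial>lborel)"
    by (rule lborel_pair.Fubini') simp
  also have "\<dots> = (\<integral>\<^sup>+x. (\<integral>\<^sup>+y. ?iB (y - f x) * ?iA y \<partial>lborel) \<partial>lborel)"
  proof (rule nn_integral_cong)
    fix x
    show "(\<integral>\<^sup>+y. ?iB y * ?iA (f x + y) \<partial>lborel) = (\<integral>\<^sup>+y. ?iB (y - f x) * ?iA y \<partial>lborel)"
      using nn_integral_lborel_translate[of "\<lambda>y. ?iB (y - f x) * ?iA y" "f x"]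
      by (simp add: add.commute)
  qed
  also have "\<dots> = (\<integral>\<^sup>+y. (\<integral>\<^sup>+x. ?iB (y - f x) * ?iA y \<partial>lborel) \<partial>lborel)"
    by (rule lborel_pair.Fubini') simp
  also have "\<dots> = (\<integral>\<^sup>+y. ?v * ?iA y \<partial>lborel)"
    by (subst nn_integral_multc) (auto simp: shiftB)
  also have "\<dots> = ?v * emeasure lborel A"
    by (simp add: nn_integral_cmult)
  finally have "?v * emeasure (distr lborel borel f) A = ?v * emeasure lborel A" .
  moreover have "?v \<noteq> 0"
    by (metis content_ball_pos emeasure_eq_ennreal_measure less_irrefl measure_def enn2real_0 zero_less_one)
  moreover have "?v \<noteq> top"
    using emeasure_lborel_ball_finite[of 0 1] by (simp add: less_top)
  ultimately show "emeasure (distr lborel borel f) A = emeasure lborel A"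
    by (simp add: ennreal_mult_cancel_left)
qed

lemma nn_integral_lborel_cart_prod:
  fixes F :: "'p::finite \<Rightarrow> real \<Rightarrow> ennreal"
  assumes "\<And>i. F i \<in> borel_measurable borel"
  shows "(\<integral>\<^sup>+x. (\<Prod>i\<in>UNIV. F i (x $ i)) \<partial>(lborel :: (real^'p) measure)) = (\<Prod>i\<in>UNIV. \<integral>\<^sup>+t. F i t \<partial>lborel)"
proof -
  let ?ax = "\<lambda>i::'p. axis i (1::real)"
  have inj: "inj ?ax" by (auto simp: inj_on_def axis_eq_axis)
  have basis: "(Basis :: (real^'p) set) = range ?ax"
    by (auto simp: Basis_vec_def)
  have inv: "inv ?ax (?ax i) = i" for i using inj by (rule inv_f_f)
  have "(\<Prod>i\<in>UNIV. F i (x $ i)) = (\<Prod>b\<in>Basis. F (inv ?ax b) (x \<bullet> b))" for x :: "real^'p"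
    by (simp add: basis prod.reindex[OF inj] inner_axis inv)
  moreover have "(\<integral>\<^sup>+x. (\<Prod>b\<in>Basis. F (inv ?ax b) (x \<bullet> b)) \<partial>(lborel :: (real^'p) measure))
      = (\<Prod>b\<in>(Basis :: (real^'p) set). \<integral>\<^sup>+t. F (inv ?ax b) t \<partial>lborel)"
    by (rule nn_integral_lborel_prod) (use assms in auto)
  ultimately show ?thesis
    by (simp add: basis prod.reindex[OF inj] inv)
qed

section \<open>The standard normal law and its linear images\<close>

lemma sets_std_normal_vec [simp, measurable_cong]: "sets std_normal_vec = sets borel"
  by (simp add: std_normal_vec_def)

lemma space_std_normal_vec [simp]: "space std_normal_vec = UNIV"
  by (simp add: std_normal_vec_def)

text \<open>The density depends on \<open>x\<close> only through its norm; this is the source of rotation invariance.\<close>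
lemma std_normal_prod_eq_norm:
  fixes x :: "real^'p"
  shows "(\<Prod>i\<in>UNIV. std_normal_density (x $ i)) = (1 / sqrt (2 * pi)) ^ CARD('p) * exp (- (norm x)\<^sup>2 / 2)"
proof -
  have "(\<Prod>i\<in>UNIV. std_normal_density (x $ i))
      = (1 / sqrt (2 * pi)) ^ CARD('p) * (\<Prod>i\<in>(UNIV::'p set). exp (- (x $ i)\<^sup>2 / 2))"
    by (simp add: std_normal_density_def prod_dividef prod.distrib power_one_over)
  also have "(\<Prod>i\<in>(UNIV::'p set). exp (- (x $ i)\<^sup>2 / 2)) = exp (\<Sum>i\<in>UNIV. - (x $ i)\<^sup>2 / 2)"
    by (simp add: exp_sum)
  also have "(\<Sum>i\<in>UNIV. - (x $ i)\<^sup>2 / 2) = - (norm x)\<^sup>2 / 2"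
    unfolding power2_norm_eq_inner
    by (simp add: inner_vec_def power2_eq_square sum_negf sum_divide_distrib[symmetric])
  finally show ?thesis .
qed

lemma borel_measurable_matrix_vector_mult [measurable (raw)]:
  fixes A :: "real^'n^'m"
  assumes "f \<in> borel_measurable M"
  shows "(\<lambda>x. A *v f x) \<in> borel_measurable M"
proof -
  have "(*v) A \<in> borel_measurable borel"
    by (intro borel_measurable_continuous_onI linear_continuous_on) simp
  then show ?thesis using assms by (rule measurable_compose[rotated])
qed

lemma std_normal_vec_rotation_invariant:
  fixes Q :: "real^'p^'p"
  assumes "orthogonal_matrix Q"
  shows "distr std_normal_vec borel ((*v) Q) = std_normal_vec"
proof -
  let ?g = "\<lambda>x :: real^'p. ennreal (\<Prod>i\<in>UNIV. std_normal_density (x $ i))"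
  have orth: "orthogonal_transformation ((*v) Q)"
    using assms by (simp add: orthogonal_transformation_matrix)
  have "?g (Q *v x) = ?g x" for x
    by (simp add: std_normal_prod_eq_norm orthogonal_transformation_norm[OF orth])
  then have "density lborel ?g = density lborel (\<lambda>x. ?g (Q *v x))" by simp
  also have "distr \<dots> borel ((*v) Q) = density (distr lborel borel ((*v) Q)) ?g"
    by (rule density_distr[symmetric]) measurable
  finally show ?thesis
    by (simp add: std_normal_vec_def lborel_distr_orthogonal[OF orth])
qed

lemma nn_integral_std_normal: "(\<integral>\<^sup>+t. ennreal (std_normal_density t) \<partial>lborel) = 1"
  by (subst nn_integral_eq_integral) auto

lemma nn_integral_std_normal_square:
  "(\<integral>\<^sup>+t. ennreal (std_normal_density t * t\<^sup>2) \<partial>lborel) = 1"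
  using std_normal_moment_even[of 1]
  by (subst nn_integral_eq_integral) (auto simp: has_bochner_integral_iff)

lemma prob_space_std_normal_vec: "prob_space (std_normal_vec :: (real^'p) measure)"
proof
  have "emeasure (std_normal_vec :: (real^'p) measure) UNIV
      = (\<integral>\<^sup>+x. (\<Prod>i\<in>UNIV. ennreal (std_normal_density (x $ i))) \<partial>(lborel :: (real^'p) measure))"
    by (simp add: std_normal_vec_def emeasure_density prod_ennreal)
  also have "\<dots> = 1"
    by (subst nn_integral_lborel_cart_prod) (auto simp: nn_integral_std_normal)
  finally show "emeasure (std_normal_vec :: (real^'p) measure) (space std_normal_vec) = 1"
    by simp
qed

text \<open>
The integrand times the density is again a product of functions of single coordinates, so the
moment factors into one-dimensional ones.
\<close>
lemma std_normal_vec_square_moment: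
  fixes i :: "'p::finite"
  shows "integrable std_normal_vec (\<lambda>z :: real^'p. (z $ i)\<^sup>2)"
    and "(\<integral>z. ((z :: real^'p) $ i)\<^sup>2 \<partial>std_normal_vec) = 1"
proof -
  let ?F = "\<lambda>k t. ennreal (std_normal_density t * (if k = i then t\<^sup>2 else 1))"
  have "(\<integral>\<^sup>+z. ennreal ((z $ i)\<^sup>2) \<partial>(std_normal_vec :: (real^'p) measure))
      = (\<integral>\<^sup>+z. ennreal ((\<Prod>k\<in>UNIV. std_normal_density (z $ k)) * (z $ i)\<^sup>2) \<partial>(lborel :: (real^'p) measure))"
    unfolding std_normal_vec_def
    by (subst nn_integral_density) (auto simp: ennreal_mult prod_nonneg)
  also have "\<dots> = (\<integral>\<^sup>+z. (\<Prod>k\<in>UNIV. ?F k (z $ k)) \<partial>(lborel :: (real^'p) measure))"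
    by (simp add: prod_ennreal prod.distrib prod.delta)
  also have "\<dots> = (\<Prod>k\<in>UNIV. \<integral>\<^sup>+t. ?F k t \<partial>lborel)"
    by (rule nn_integral_lborel_cart_prod) simp
  also have "\<dots> = 1"
    proof (intro prod.neutral ballI)
    fix k
    show "(\<integral>\<^sup>+t. ?F k t \<partial>lborel) = 1"
      by (cases "k = i") (simp_all add: nn_integral_std_normal nn_integral_std_normal_square)
  qed
  finally have eq: "(\<integral>\<^sup>+z. ennreal ((z $ i)\<^sup>2) \<partial>(std_normal_vec :: (real^'p) measure)) = ennreal 1"
    by simp
  then have "integrable std_normal_vec (\<lambda>z :: real^'p. (z $ i)\<^sup>2) \<and> (\<integral>z. ((z :: real^'p) $ i)\<^sup>2 \<partial>std_normal_vec) = 1"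
    by (subst (asm) nn_integral_eq_integrable) auto
  then show "integrable std_normal_vec (\<lambda>z :: real^'p. (z $ i)\<^sup>2)"
    and "(\<integral>z. ((z :: real^'p) $ i)\<^sup>2 \<partial>std_normal_vec) = 1" by auto
qed

lemma std_normal_vec_mixed_moment:
  fixes i j :: "'p::finite"
  shows "integrable std_normal_vec (\<lambda>z :: real^'p. z $ i * z $ j)"
    and "(\<integral>z. (z :: real^'p) $ i * z $ j \<partial>std_normal_vec) = (if i = j then 1 else 0)"
proof -
  show int: "integrable std_normal_vec (\<lambda>z :: real^'p. z $ i * z $ j)"
  proof (rule Bochner_Integration.integrable_bound)
    show "integrable std_normal_vec (\<lambda>z :: real^'p. (z $ i)\<^sup>2 + (z $ j)\<^sup>2)"
      by (intro Bochner_Integration.integrable_add std_normal_vec_square_moment)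
    show "AE z in std_normal_vec. norm ((z :: real^'p) $ i * z $ j) \<le> norm ((z $ i)\<^sup>2 + (z $ j)\<^sup>2)"
    proof (rule AE_I2)
      fix z :: "real^'p"
      have "2 * (\<bar>z $ i\<bar> * \<bar>z $ j\<bar>) \<le> (z $ i)\<^sup>2 + (z $ j)\<^sup>2"
        using sum_squares_bound[of "\<bar>z $ i\<bar>" "\<bar>z $ j\<bar>"] by simp
      then show "norm (z $ i * z $ j) \<le> norm ((z $ i)\<^sup>2 + (z $ j)\<^sup>2)"
        by (simp add: abs_mult)
          (smt (verit) mult_nonneg_nonneg abs_ge_zero)
    qed
  qed simp
  show "(\<integral>z. (z :: real^'p) $ i * z $ j \<partial>std_normal_vec) = (if i = j then 1 else 0)"
  proof (cases "i = j")
    case True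
    then show ?thesis
      using std_normal_vec_square_moment(2)[of i] by (simp add: power2_eq_square)
  next
    case False
    \<comment> \<open>Flipping the sign of the coordinate \<open>i\<close> preserves the law and negates the integrand.\<close>
    let ?Q = "(\<chi> k l. if k = l then if k = i then - 1 else 1 else 0) :: real^'p^'p"
    have Q: "(?Q *v z) $ k = (if k = i then - z $ k else z $ k)" for z k
      by (simp add: matrix_vector_mult_def if_distrib[of "\<lambda>a. a * _"] cong: if_cong)
    have "transpose ?Q ** ?Q = mat 1"
      by (auto simp: vec_eq_iff matrix_matrix_mult_def transpose_def mat_def if_distrib[of "\<lambda>a. a * _"]
          cong: if_cong)
    then have "orthogonal_matrix ?Q" by (simp add: orthogonal_matrix)
    then have "(\<integral>z. (z :: real^'p) $ i * z $ j \<partial>std_normal_vec)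
        = (\<integral>z. z $ i * z $ j \<partial>distr std_normal_vec borel ((*v) ?Q))"
      by (simp only: std_normal_vec_rotation_invariant)
    also have "\<dots> = (\<integral>z. (?Q *v z) $ i * (?Q *v z) $ j \<partial>std_normal_vec)"
      by (rule integral_distr) measurable
    also have "\<dots> = - (\<integral>z. (z :: real^'p) $ i * z $ j \<partial>std_normal_vec)"
      using False by (simp add: Q)
    finally show ?thesis using False by simp
  qed
qed

lemma std_normal_vec_quadratic_form:
  fixes B :: "real^'p^'p"
  shows "integrable std_normal_vec (\<lambda>z. z \<bullet> (B *v z))"
    and "(\<integral>z. z \<bullet> (B *v z) \<partial>std_normal_vec) = trace B"
proof -
  have eq: "z \<bullet> (B *v z) = (\<Sum>i\<in>UNIV. \<Sum>j\<in>UNIV. B $ i $ j * (z $ i * z $ j))" for z :: "real^'p"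
    by (simp add: inner_vec_def matrix_vector_mult_def sum_distrib_left mult_ac)
  show "integrable std_normal_vec (\<lambda>z. z \<bullet> (B *v z))"
    unfolding eq by (intro Bochner_Integration.integrable_sum integrable_mult_right std_normal_vec_mixed_moment)
  have "(\<integral>z. z \<bullet> (B *v z) \<partial>std_normal_vec) = (\<Sum>i\<in>UNIV. \<Sum>j\<in>UNIV. B $ i $ j * (if i = j then 1 else 0))"
    unfolding eq
    by (subst Bochner_Integration.integral_sum,
        intro Bochner_Integration.integrable_sum integrable_mult_right std_normal_vec_mixed_moment,
        subst Bochner_Integration.integral_sum,
        intro integrable_mult_right std_normal_vec_mixed_moment)
      (simp add: std_normal_vec_mixed_moment)
  also have "\<dots> = trace B"
    by (simp add: trace_def if_distrib[of "\<lambda>a. _ * a"] cong: if_cong)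
  finally show "(\<integral>z. z \<bullet> (B *v z) \<partial>std_normal_vec) = trace B" .
qed

(* Otherwise the simplifier turns transposed factors into left multiplications, which do not combine
   with matrix products. *)
declare transpose_matrix_vector [simp del]

lemma inner_matrix_vector_transpose:
  fixes A :: "real^'n^'m"
  shows "(A *v x) \<bullet> y = x \<bullet> (transpose A *v y)"
  using dot_lmul_matrix[of y A x] by (simp add: transpose_matrix_vector inner_commute)

text \<open>
The parameter is a factor \<open>A\<close> of the covariance matrix \<open>A A\<^sup>T\<close>. Explicit factors make it possible
to realize several normal laws on the same standard normal vector and hence to couple them.
\<close>
definition gauss :: "real^'p^'p \<Rightarrow> (real^'p) measure" where
  "gauss A = distr std_normal_vec borel ((*v) A)"

text \<open>If \<open>A A\<^sup>T = B B\<^sup>T\<close>, then \<open>A = B Q\<close> with \<open>Q = B\<inverse> A\<close> orthogonal, and \<open>Q Z\<close> has the law of \<open>Z\<close>.\<close>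
lemma gauss_eqI:
  fixes A B :: "real^'p^'p"
  assumes "invertible B" and AB: "A ** transpose A = B ** transpose B"
  shows "gauss A = gauss B"
proof -
  obtain C where C: "B ** C = mat 1" "C ** B = mat 1"
    using assms(1) unfolding invertible_def by blast
  let ?Q = "C ** A"
  have "?Q ** transpose ?Q = C ** (A ** transpose A) ** transpose C"
    by (simp only: matrix_transpose_mul matrix_mul_assoc)
  also have "\<dots> = (C ** B) ** transpose (C ** B)"
    by (simp only: AB matrix_transpose_mul matrix_mul_assoc)
  finally have QQ: "?Q ** transpose ?Q = mat 1" by (simp add: C transpose_mat)
  have "orthogonal_matrix ?Q"
    using orthogonal_matrix[of "transpose ?Q"] QQ by (simp only: orthogonal_matrix_transpose transpose_transpose)
  then have Q: "distr std_normal_vec borel ((*v) ?Q) = std_normal_vec"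
    by (rule std_normal_vec_rotation_invariant)
  have "(*v) A = (*v) B \<circ> (*v) ?Q"
    by (simp add: fun_eq_iff matrix_vector_mul_assoc matrix_mul_assoc C)
  then have "gauss A = distr std_normal_vec borel ((*v) B \<circ> (*v) ?Q)"
    unfolding gauss_def by (rule arg_cong)
  also have "\<dots> = distr (distr std_normal_vec borel ((*v) ?Q)) borel ((*v) B)"
    by (rule distr_distr[symmetric]) measurable
  finally show ?thesis by (simp only: Q gauss_def)
qed

text \<open>The factor selected by choice may be traded for any explicit invertible one.\<close>
lemma normal0_eq_gauss:
  fixes B :: "real^'p^'p"
  assumes "invertible B"
  shows "normal0 (B ** transpose B) = gauss B"
proof -
  let ?A = "SOME A :: real^'p^'p. A ** transpose A = B ** transpose B"
  have A: "?A ** transpose ?A = B ** transpose B" 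
    by (rule someI[of "\<lambda>A. A ** transpose A = B ** transpose B" B]) (rule refl)
  have "normal0 (B ** transpose B) = gauss ?A" by (simp only: normal0_def gauss_def)
  then show ?thesis using gauss_eqI[OF assms A] by (rule trans)
qed

lemma gauss_quadratic_form:
  fixes A X :: "real^'p^'p"
  shows "integrable (gauss A) (\<lambda>\<xi>. \<xi> \<bullet> (X *v \<xi>))"
    and "(\<integral>\<xi>. \<xi> \<bullet> (X *v \<xi>) \<partial>gauss A) = trace (X ** (A ** transpose A))"
proof -
  have eq: "(A *v z) \<bullet> (X *v (A *v z)) = z \<bullet> ((transpose A ** X ** A) *v z)" for z
    by (simp add: inner_matrix_vector_transpose matrix_vector_mul_assoc matrix_mul_assoc)
  have m: "(*v) A \<in> measurable std_normal_vec borel" by measurable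
  have f: "(\<lambda>\<xi>. \<xi> \<bullet> (X *v \<xi>)) \<in> borel_measurable borel" by measurable
  show "integrable (gauss A) (\<lambda>\<xi>. \<xi> \<bullet> (X *v \<xi>))"
    unfolding gauss_def integrable_distr_eq[OF m f] eq by (rule std_normal_vec_quadratic_form)
  have "trace (transpose A ** X ** A) = trace (X ** (A ** transpose A))"
    using trace_mul_sym[of "transpose A" "X ** A"] by (simp add: matrix_mul_assoc)
  then show "(\<integral>\<xi>. \<xi> \<bullet> (X *v \<xi>) \<partial>gauss A) = trace (X ** (A ** transpose A))"
    unfolding gauss_def integral_distr[OF m f] eq std_normal_vec_quadratic_form by simp
qed

section \<open>Diagonalization of symmetric matrices\<close>

text \<open>
A maximizer \<open>v\<close> of the Rayleigh quotient on the unit sphere of \<open>W\<close>, with maximum \<open>m\<close>, is an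
eigenvector: the form \<open>t\<close> of \<open>m I - X\<close> is nonnegative on \<open>W\<close> and vanishes at \<open>v\<close>. Moving from \<open>v\<close> by
\<open>- s w\<close> with \<open>w = m v - X v\<close> would decrease it at rate \<open>2 \<parallel>w\<parallel>\<^sup>2\<close>, so \<open>w = 0\<close>.
\<close>
lemma symmetric_matrix_eigenvector_in_invariant_subspace:
  fixes X :: "real^'p^'p"
  assumes sym: "transpose X = X" and W: "subspace W" "W \<noteq> {0}"
    and inv: "\<And>w. w \<in> W \<Longrightarrow> X *v w \<in> W"
  obtains v m where "v \<in> W" "norm v = 1" "X *v v = m *\<^sub>R v"
proof -
  have symi: "x \<bullet> (X *v y) = y \<bullet> (X *v x)" for x y
    by (metis inner_matrix_vector_transpose inner_commute sym)
  obtain w0 where w0: "w0 \<in> W" "w0 \<noteq> 0" using W subspace_0 by blast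
  let ?K = "sphere 0 1 \<inter> W"
  have "compact ?K" using closed_subspace[OF W(1)] by (intro compact_Int_closed) auto
  moreover have "w0 /\<^sub>R norm w0 \<in> ?K"
    using w0 subspace_scale[OF W(1)] by simp
  moreover have "continuous_on ?K (\<lambda>x. x \<bullet> (X *v x))"
    by (intro continuous_intros linear_continuous_on) simp
  ultimately obtain v where v: "v \<in> ?K" and max: "\<And>w. w \<in> ?K \<Longrightarrow> w \<bullet> (X *v w) \<le> v \<bullet> (X *v v)"
    using continuous_attains_sup[of ?K "\<lambda>x. x \<bullet> (X *v x)"] by blast
  define m where "m = v \<bullet> (X *v v)"
  define t where "t = (\<lambda>x y. m * (x \<bullet> y) - x \<bullet> (X *v y))"
  have nonneg: "t w w \<ge> 0" if "w \<in> W" for w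
  proof (cases "w = 0")
    case False
    let ?u = "w /\<^sub>R norm w"
    have "?u \<in> ?K" using that False subspace_scale[OF W(1)] by simp
    then have "?u \<bullet> (X *v ?u) \<le> m" using max m_def by blast
    moreover have "?u \<bullet> (X *v ?u) = (w \<bullet> (X *v w)) / (norm w)\<^sup>2"
      by (simp add: matrix_vector_mult_scaleR divide_inverse power2_eq_square mult.commute)
    ultimately have "(w \<bullet> (X *v w)) / (norm w)\<^sup>2 \<le> m" by (simp only:)
    then show ?thesis
      using False by (simp add: t_def field_simps power2_norm_eq_inner)
  qed (simp add: t_def)
  define w where "w = m *\<^sub>R v - X *v v"
  have vW: "v \<in> W" and v1: "v \<bullet> v = 1" using v by (auto simp: norm_eq_1)
  then have wW: "w \<in> W"
    unfolding w_def by (intro subspace_diff subspace_scale W inv)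
  have step: "2 * (w \<bullet> w) \<le> s * t w w" if "s > 0" for s
  proof -
    have "0 \<le> t (v - s *\<^sub>R w) (v - s *\<^sub>R w)"
      by (intro nonneg subspace_diff subspace_scale W vW wW)
    also have "\<dots> = t v v - 2 * s * t w v + s\<^sup>2 * t w w"
      using symi[of v w]
      by (simp add: t_def matrix_vector_mult_diff_distrib matrix_vector_mult_scaleR inner_diff_left
          inner_diff_right inner_commute[of v w] algebra_simps power2_eq_square)
    also have "t v v = 0" by (simp add: t_def v1 m_def)
    also have "t w v = w \<bullet> w"
      by (simp add: t_def w_def inner_diff_left inner_diff_right algebra_simps)
    finally have "2 * s * (w \<bullet> w) \<le> s * (s * t w w)" by (simp add: power2_eq_square)
    then show ?thesis using that by (simp add: mult.left_commute)
  qed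
  have "((\<lambda>s. s * t w w) \<longlongrightarrow> 0 * t w w) (at_right 0)" by (intro tendsto_intros)
  then have "2 * (w \<bullet> w) \<le> 0"
    using tendsto_lowerbound[of "\<lambda>s. s * t w w" 0 "at_right 0" "2 * (w \<bullet> w)"] step
    by (simp add: eventually_at_filter)
  then have "w = 0" using inner_ge_zero[of w] by simp
  then have "X *v v = m *\<^sub>R v" by (simp add: w_def)
  with vW v show thesis by (intro that[of v m]) auto
qed

definition diag_matrix :: "('p \<Rightarrow> real) \<Rightarrow> real^'p^'p" where
  "diag_matrix d = (\<chi> i j. if i = j then d i else 0)"

text \<open>
An orthonormal set \<open>B\<close> of eigenvectors of maximal cardinality spans the space: its orthogonal
complement is invariant under \<open>X\<close>, so if it were nonzero it would contain a further unit eigenvector.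
\<close>
theorem spectral_theorem_symmetric:
  fixes X :: "real^'p^'p"
  assumes sym: "transpose X = X"
  obtains U :: "real^'p^'p" and d where "orthogonal_matrix U" "X = U ** diag_matrix d ** transpose U"
proof -
  define P where "P B \<longleftrightarrow> pairwise orthogonal B \<and> (\<forall>v\<in>B. norm v = 1 \<and> (\<exists>m. X *v v = m *\<^sub>R v))"
    for B :: "(real^'p) set"
  have indep: "independent B" if "P B" for B
    using that by (intro pairwise_orthogonal_independent) (auto simp: P_def)
  have bound: "card B \<le> DIM(real^'p)" if "P B" for B
    using indep[OF that] by (rule independent_bound[THEN conjunct2])
  have "P {}" by (simp add: P_def)
  moreover have "\<forall>B. P B \<longrightarrow> card B < DIM(real^'p) + 1" using bound by (simp add: less_Suc_eq_le)
  ultimately obtain B where PB: "P B" and maxB: "\<And>B'. P B' \<Longrightarrow> card B' \<le> card B"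
    using ex_has_greatest_nat[of P "{}" card "DIM(real^'p) + 1"] by blast
  have finB: "finite B" using indep[OF PB] by (rule independent_imp_finite)
  define W where "W = {x. \<forall>b\<in>B. orthogonal x b}"
  have subW: "subspace W"
    by (auto simp: W_def subspace_def orthogonal_clauses)
  have invW: "X *v w \<in> W" if "w \<in> W" for w
  proof -
    have "(X *v w) \<bullet> b = 0" if "b \<in> B" for b
    proof -
      obtain m where "X *v b = m *\<^sub>R b" using PB \<open>b \<in> B\<close> by (auto simp: P_def)
      then show ?thesis
        using \<open>w \<in> W\<close> \<open>b \<in> B\<close> by (simp add: inner_matrix_vector_transpose sym W_def orthogonal_def)
    qed
    then show ?thesis by (simp add: W_def orthogonal_def)
  qed
  have "W = {0}"
  proof (rule ccontr)
    assume "W \<noteq> {0}"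
    then obtain v m where v: "v \<in> W" "norm v = 1" "X *v v = m *\<^sub>R v"
      using symmetric_matrix_eigenvector_in_invariant_subspace[OF sym subW] invW by blast
    have "P (insert v B)"
      using PB v by (auto simp: P_def pairwise_insert W_def orthogonal_commute)
    moreover have "v \<notin> B"
      using v by (auto simp: W_def orthogonal_def)
    ultimately show False using maxB[of "insert v B"] finB by simp
  qed
  have "\<not> dim B < DIM(real^'p)"
  proof
    assume "dim B < DIM(real^'p)"
    then obtain x where "x \<noteq> 0" "\<And>y. y \<in> span B \<Longrightarrow> orthogonal x y"
      using orthogonal_to_subspace_exists by blast
    then have "x \<in> W" by (simp add: W_def span_base)
    with \<open>W = {0}\<close> \<open>x \<noteq> 0\<close> show False by simp
  qed
  then have "card B = CARD('p)"
    using bound[OF PB] dim_eq_card_independent[OF indep[OF PB]] by simp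
  then obtain f where f: "bij_betw f (UNIV :: 'p set) B"
    using finB finite_same_card_bij[of "UNIV :: 'p set" B] by auto
  then have fB: "f i \<in> B" for i by (auto simp: bij_betw_def)
  then have "\<forall>i. \<exists>m. X *v f i = m *\<^sub>R f i"
    using PB by (simp add: P_def)
  then obtain d where d: "\<And>i. X *v f i = d i *\<^sub>R f i"
    by metis
  define U where "U = (\<chi> i j. f j $ i)"
  have col: "column j U = f j" for j
    by (simp add: column_def U_def vec_eq_iff)
  have "orthogonal_matrix U"
    unfolding orthogonal_matrix_orthonormal_columns col
    using PB fB injD[OF bij_betw_imp_inj_on[OF f]] unfolding P_def pairwise_def by metis
  moreover have "X ** U = U ** diag_matrix d"
  proof -
    have "(X ** U) $ i $ j = (X *v f j) $ i" for i j
      by (simp add: matrix_matrix_mult_def matrix_vector_mult_def U_def)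
    moreover have "(U ** diag_matrix d) $ i $ j = d j * f j $ i" for i j
      by (simp add: matrix_matrix_mult_def diag_matrix_def U_def if_distrib[of "\<lambda>a. _ * a"] mult.commute cong: if_cong)
    ultimately show ?thesis by (simp add: vec_eq_iff d)
  qed
  moreover have "X = X ** U ** transpose U"
    using \<open>orthogonal_matrix U\<close> by (simp add: orthogonal_matrix_def matrix_mul_assoc[symmetric])
  ultimately have "X = U ** diag_matrix d ** transpose U" by simp
  with \<open>orthogonal_matrix U\<close> show thesis by (rule that)
qed

lemma diag_matrix_mult: "diag_matrix d ** diag_matrix e = diag_matrix (\<lambda>i. d i * e i)"
  by (simp add: diag_matrix_def matrix_matrix_mult_def vec_eq_iff if_distrib[of "\<lambda>a. _ * a"] if_distrib[of "\<lambda>a. a * _"] cong: if_cong)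

lemma diag_matrix_mult_component: "(diag_matrix d ** A) $ i $ j = d i * A $ i $ j"
  by (simp add: diag_matrix_def matrix_matrix_mult_def if_distrib[of "\<lambda>a. a * _"] cong: if_cong)

lemma transpose_diag_matrix [simp]: "transpose (diag_matrix d) = diag_matrix d"
  by (auto simp: diag_matrix_def transpose_def vec_eq_iff)

lemma diag_matrix_one: "diag_matrix (\<lambda>i. 1) = mat 1"
  by (simp add: diag_matrix_def mat_def)

lemma orthogonal_conj_mult:
  fixes U :: "real^'p^'p"
  assumes "orthogonal_matrix U"
  shows "(U ** A ** transpose U) ** (U ** B ** transpose U) = U ** (A ** B) ** transpose U"
proof -
  have "(U ** A ** transpose U) ** (U ** B ** transpose U) = U ** A ** (transpose U ** U) ** B ** transpose U"
    by (simp only: matrix_mul_assoc)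
  also have "transpose U ** U = mat 1" using assms by (simp add: orthogonal_matrix_def)
  finally show ?thesis by (simp add: matrix_mul_assoc)
qed

lemma diag_conj_quadratic_form:
  fixes U :: "real^'p^'p"
  shows "x \<bullet> ((U ** diag_matrix d ** transpose U) *v x) = (\<Sum>i\<in>UNIV. d i * ((transpose U *v x) $ i)\<^sup>2)"
proof -
  have "x \<bullet> ((U ** diag_matrix d ** transpose U) *v x)
      = (transpose U *v x) \<bullet> (diag_matrix d *v (transpose U *v x))"
    by (simp add: inner_matrix_vector_transpose matrix_vector_mul_assoc matrix_mul_assoc)
  also have "\<dots> = (\<Sum>i\<in>UNIV. d i * ((transpose U *v x) $ i)\<^sup>2)"
  proof -
    have "(diag_matrix d *v y) $ i = d i * y $ i" for y :: "real^'p" and i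
      by (simp add: matrix_vector_mult_def diag_matrix_def if_distrib[of "\<lambda>a. a * _"] cong: if_cong)
    then show ?thesis by (simp add: inner_vec_def power2_eq_square mult.left_commute)
  qed
  finally show ?thesis .
qed

lemma pd_diag_conj_iff:
  fixes U :: "real^'p^'p"
  assumes U: "orthogonal_matrix U"
  shows "pd (U ** diag_matrix d ** transpose U) \<longleftrightarrow> (\<forall>i. d i > 0)"
proof
  assume pd: "pd (U ** diag_matrix d ** transpose U)"
  show "\<forall>i. d i > 0"
  proof
    fix i
    let ?x = "U *v axis i 1"
    have x: "transpose U *v ?x = axis i 1"
      using U by (simp add: matrix_vector_mul_assoc orthogonal_matrix_def)
    have "?x \<noteq> 0"
    proof
      assume "?x = 0"
      then have "axis i (1::real) = (0 :: real^'p)" using x by simp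
      then show False by (simp add: axis_eq_0_iff)
    qed
    then have "0 < (\<Sum>k\<in>UNIV. d k * ((transpose U *v ?x) $ k)\<^sup>2)"
      using pd unfolding pd_def diag_conj_quadratic_form by blast
    also have "\<dots> = d i"
      unfolding x by (simp add: axis_def if_distrib[of "\<lambda>a. a\<^sup>2"] if_distrib[of "\<lambda>a. _ * a"] cong: if_cong)
    finally show "d i > 0" .
  qed
next
  assume d: "\<forall>i. d i > 0"
  have "x \<bullet> ((U ** diag_matrix d ** transpose U) *v x) > 0" if "x \<noteq> 0" for x
  proof -
    have "U *v (transpose U *v x) = x"
      using U by (simp add: matrix_vector_mul_assoc orthogonal_matrix_def)
    then have "transpose U *v x \<noteq> 0" using that by (metis matrix_vector_mult_0_right)
    then obtain i where "(transpose U *v x) $ i \<noteq> 0" by (auto simp: vec_eq_iff)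
    then show ?thesis
      unfolding diag_conj_quadratic_form using d
      by (intro sum_pos2[of _ i]) (auto simp: less_imp_le)
  qed
  then show "pd (U ** diag_matrix d ** transpose U)"
    by (simp add: pd_def matrix_transpose_mul matrix_mul_assoc)
qed

text \<open>The factor is the positive definite square root.\<close>
lemma pd_factorization:
  fixes S :: "real^'p^'p"
  assumes "pd S"
  obtains B :: "real^'p^'p" where "invertible B" "S = B ** transpose B"
proof -
  obtain U d where U: "orthogonal_matrix U" and S: "S = U ** diag_matrix d ** transpose U"
    using spectral_theorem_symmetric assms unfolding pd_def by metis
  have d: "d i > 0" for i
    using assms pd_diag_conj_iff[OF U] S by auto
  let ?B = "U ** diag_matrix (\<lambda>i. sqrt (d i)) ** transpose U"
  let ?C = "U ** diag_matrix (\<lambda>i. 1 / sqrt (d i)) ** transpose U"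
  have [simp]: "sqrt (d i) \<noteq> 0" "sqrt (d i) * sqrt (d i) = d i" for i
    using d[of i] by auto
  have "?B ** ?C = mat 1"
    using U by (simp add: orthogonal_conj_mult[OF U] diag_matrix_mult less_imp_neq[OF d, symmetric]
        diag_matrix_one orthogonal_matrix_def)
  then have "invertible ?B"
    by (auto simp: invertible_right_inverse)
  moreover have "transpose ?B = ?B" by (simp add: matrix_transpose_mul matrix_mul_assoc)
  then have "S = ?B ** transpose ?B"
    by (simp add: S orthogonal_conj_mult[OF U] diag_matrix_mult abs_of_pos[OF d])
  ultimately show thesis by (rule that)
qed

lemma matrix_inv_eqI:
  fixes A B :: "real^'p^'p"
  assumes "A ** B = mat 1"
  shows "matrix_inv A = B"
proof -
  have "B ** A = mat 1" using assms by (simp add: matrix_left_right_inverse)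
  then have "A ** matrix_inv A = mat 1 \<and> matrix_inv A ** A = mat 1"
    unfolding matrix_inv_def using assms
    by (intro someI[of "\<lambda>C. A ** C = mat 1 \<and> C ** A = mat 1" B]) simp
  then have "matrix_inv A = (B ** A) ** matrix_inv A" "B = B ** (A ** matrix_inv A)"
    using \<open>B ** A = mat 1\<close> by simp_all
  then show ?thesis by (simp only: matrix_mul_assoc)
qed

lemma matrix_diff_ldistrib: "A ** (B - C) = A ** B - A ** (C :: real^'n^'m)"
  by (simp add: matrix_matrix_mult_def vec_eq_iff sum_subtractf right_diff_distrib)

lemma matrix_diff_rdistrib: "(B - C) ** A = B ** A - C ** (A :: real^'n^'m)"
  by (simp add: matrix_matrix_mult_def vec_eq_iff sum_subtractf left_diff_distrib)

lemma trace_scaleR: "trace (k *\<^sub>R A) = k * trace (A :: real^'n^'n)"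
  by (simp add: trace_def sum_distrib_left)

lemma diag_conj_scaleR:
  fixes U :: "real^'p^'p"
  shows "k *\<^sub>R (U ** diag_matrix d ** transpose U) = U ** diag_matrix (\<lambda>i. k * d i) ** transpose U"
proof -
  have "diag_matrix (\<lambda>i. k * d i) = k *\<^sub>R diag_matrix d"
    by (simp add: diag_matrix_def vec_eq_iff)
  then show ?thesis by (simp add: matrix_scalar_ac scalar_matrix_assoc)
qed

lemma diag_conj_diff:
  fixes U :: "real^'p^'p"
  shows "U ** diag_matrix d ** transpose U - U ** diag_matrix e ** transpose U
    = U ** diag_matrix (\<lambda>i. d i - e i) ** transpose U"
proof -
  have "diag_matrix (\<lambda>i. d i - e i) = diag_matrix d - diag_matrix e"
    by (simp add: diag_matrix_def vec_eq_iff)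
  then show ?thesis by (simp add: matrix_diff_ldistrib matrix_diff_rdistrib)
qed

lemma diag_conj_one:
  "orthogonal_matrix U \<Longrightarrow> U ** diag_matrix (\<lambda>i. 1) ** transpose U = (mat 1 :: real^'p^'p)"
  by (simp add: diag_matrix_one orthogonal_matrix_def)

lemma transpose_diag_conj:
  fixes U :: "real^'p^'p"
  shows "transpose (U ** diag_matrix d ** transpose U) = U ** diag_matrix d ** transpose U"
  by (simp add: matrix_transpose_mul matrix_mul_assoc)

lemma trace_diag_conj_sandwich:
  fixes U S :: "real^'p^'p"
  assumes U: "orthogonal_matrix U"
  shows "trace ((U ** diag_matrix d ** transpose U) ** S ** (U ** diag_matrix d ** transpose U))
    = (\<Sum>i\<in>UNIV. (d i)\<^sup>2 * (column i U \<bullet> (S *v column i U)))"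
proof -
  let ?E = "U ** diag_matrix d ** transpose U" and ?D = "diag_matrix (\<lambda>i. (d i)\<^sup>2)"
  have entry: "(transpose U ** S ** U) $ i $ i = column i U \<bullet> (S *v column i U)" for i
    by (simp add: inner_vec_def matrix_vector_mult_def matrix_matrix_mult_def transpose_def column_def
        sum_distrib_left sum_distrib_right mult_ac)
      (subst sum.swap, simp add: mult_ac)
  have "trace (?E ** S ** ?E) = trace (?E ** ?E ** S)"
    using trace_mul_sym[of "?E ** S" ?E] by (simp add: matrix_mul_assoc)
  also have "?E ** ?E = U ** ?D ** transpose U"
    unfolding orthogonal_conj_mult[OF U] diag_matrix_mult by (simp add: power2_eq_square)
  also have "trace (\<dots> ** S) = trace (?D ** (transpose U ** S ** U))"
    using trace_mul_sym[of U "?D ** transpose U ** S"] by (simp add: matrix_mul_assoc)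
  also have "\<dots> = (\<Sum>i\<in>UNIV. (d i)\<^sup>2 * (transpose U ** S ** U) $ i $ i)"
    by (simp add: trace_def diag_matrix_mult_component)
  finally show ?thesis by (simp only: entry)
qed

lemma resolvent_diag_conj:
  fixes U :: "real^'p^'p"
  assumes U: "orthogonal_matrix U" and l: "\<And>i. l i \<noteq> g"
  shows "(g *\<^sub>R mat 1 - U ** diag_matrix l ** transpose U)
      ** (U ** diag_matrix (\<lambda>i. 1 / (g - l i)) ** transpose U) = mat 1"
proof -
  have "g - l i \<noteq> 0" for i using l[of i] by simp
  then show ?thesis
    unfolding diag_conj_one[OF U, symmetric] diag_conj_scaleR diag_conj_diff
      orthogonal_conj_mult[OF U] diag_matrix_mult by simp
qed

section \<open>The equation for the multiplier\<close>

text \<open>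
This identifies the algebraic equation for \<open>\<gamma>\<close>. With \<open>R\<close> the resolvent of a symmetric \<open>X\<close>, the
matrix \<open>g R - I\<close> is the displacement \<open>x - y\<close> as a function of \<open>y\<close> under the optimal transport
\<open>x = g R y\<close>, and the left side is the mean square displacement when \<open>y\<close> has covariance \<open>S\<close>.
\<close>
lemma trace_resolvent_displacement:
  fixes R S :: "real^'p^'p"
  shows "trace ((g *\<^sub>R R - mat 1) ** S ** (g *\<^sub>R R - mat 1))
    = trace S - 2 * g * trace (R ** S) + g\<^sup>2 * trace (R ** S ** R)"
proof -
  have "(g *\<^sub>R R - mat 1) ** S ** (g *\<^sub>R R - mat 1)
      = g\<^sup>2 *\<^sub>R (R ** S ** R) - g *\<^sub>R (S ** R) - (g *\<^sub>R (R ** S) - S)"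
    by (simp add: matrix_diff_ldistrib matrix_diff_rdistrib matrix_scalar_ac
        scalar_matrix_assoc[symmetric] scaleR_diff_right power2_eq_square)
  then show ?thesis
    by (simp add: trace_sub trace_scaleR trace_mul_sym[of S R])
qed

text \<open>
Every summand decreases strictly in \<open>g\<close> above all \<open>l i\<close>, which gives uniqueness. Existence is the
intermediate value theorem: the sum tends to \<open>0\<close> at infinity, and close enough above the largest \<open>l k\<close>
the summand of \<open>k\<close> alone reaches the value \<open>r\<^sup>2\<close>.
\<close>
lemma secular_equation_unique_root:
  fixes l c :: "'p::finite \<Rightarrow> real"
  assumes l: "\<And>i. l i > 0" and c: "\<And>i. c i > 0" and r: "r > 0"
  obtains \<gamma> where "\<And>i. l i < \<gamma>" "(\<Sum>i\<in>UNIV. (l i / (\<gamma> - l i))\<^sup>2 * c i) = r\<^sup>2"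
    "\<And>g. (\<forall>i. l i < g) \<Longrightarrow> (\<Sum>i\<in>UNIV. (l i / (g - l i))\<^sup>2 * c i) = r\<^sup>2 \<Longrightarrow> g = \<gamma>"
proof -
  define F where "F g = (\<Sum>i\<in>UNIV. (l i / (g - l i))\<^sup>2 * c i)" for g
  have anti: "F g' < F g" if "\<forall>i. l i < g" "g < g'" for g g'
    unfolding F_def
  proof (rule sum_strict_mono)
    fix i
    have "l i < g" using that(1) by blast
    moreover from this have "l i < g'" using that(2) by linarith
    ultimately have "l i / (g' - l i) < l i / (g - l i)" "0 \<le> l i / (g' - l i)"
      using that(2) l[of i] by (auto intro!: divide_strict_left_mono mult_pos_pos)
    then show "(l i / (g' - l i))\<^sup>2 * c i < (l i / (g - l i))\<^sup>2 * c i"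
      using c by (intro mult_strict_right_mono power_strict_mono) auto
  qed auto
  have "Max (range l) \<in> range l" by (rule Max_in) auto
  then obtain k where k: "Max (range l) = l k" by (metis rangeE)
  have lk: "l i \<le> l k" for i unfolding k[symmetric] by (rule Max_ge) auto
  \<comment> \<open>At \<open>a\<close> the summand of the largest eigenvalue alone equals the target value.\<close>
  define a where "a = l k + l k * sqrt (c k) / r"
  have ak: "l k < a" using l[of k] c[of k] r by (simp add: a_def)
  then have la: "l i < a" for i using lk[of i] by linarith
  have "(l k / (a - l k))\<^sup>2 * c k = r\<^sup>2"
    using l[of k] c[of k] r by (simp add: a_def field_simps power2_eq_square)
  then have Fa: "r\<^sup>2 \<le> F a"
    unfolding F_def
    using member_le_sum[of k UNIV "\<lambda>i. (l i / (a - l i))\<^sup>2 * c i"] c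
    by (auto simp: less_imp_le)
  have "((\<lambda>g. (l i / (g - l i))\<^sup>2 * c i) \<longlongrightarrow> 0) at_top" for i
  proof -
    have "((\<lambda>g. l i / (g - l i)) \<longlongrightarrow> 0) at_top"
      by (intro real_tendsto_divide_at_top[OF tendsto_const]
          filterlim_tendsto_add_at_top[where c = "- l i" and f = "\<lambda>_. - l i",
            OF tendsto_const filterlim_ident, simplified add.commute, simplified])
    then show ?thesis
      using tendsto_mult_left_zero[OF tendsto_null_power[of _ _ 2]] by auto
  qed
  then have "(F \<longlongrightarrow> (\<Sum>i\<in>(UNIV::'p set). 0)) at_top"
    unfolding F_def[abs_def] by (intro tendsto_sum)
  then have "\<forall>\<^sub>F g in at_top. F g < r\<^sup>2"
    using r by (intro order_tendstoD(2)) auto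
  then obtain b where b: "F b < r\<^sup>2" "a \<le> b"
    by (metis eventually_at_top_linorder linorder_linear)
  have "continuous_on {a..b} F"
    unfolding F_def[abs_def]
    using la by (intro continuous_intros) (metis atLeastAtMost_iff diff_gt_0_iff_gt less_irrefl less_le_trans)
  then obtain \<gamma> where \<gamma>: "a \<le> \<gamma>" "F \<gamma> = r\<^sup>2"
    using IVT2'[of F b "r\<^sup>2" a] Fa b by auto
  show thesis
  proof (rule that[of \<gamma>])
    show l\<gamma>: "l i < \<gamma>" for i using la[of i] \<gamma> by linarith
    show "(\<Sum>i\<in>UNIV. (l i / (\<gamma> - l i))\<^sup>2 * c i) = r\<^sup>2"
      using \<gamma> by (simp add: F_def)
    fix g assume g: "\<forall>i. l i < g" "(\<Sum>i\<in>UNIV. (l i / (g - l i))\<^sup>2 * c i) = r\<^sup>2"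
    then have "F g = F \<gamma>" using \<gamma> by (simp add: F_def)
    then show "g = \<gamma>"
      using anti[of g \<gamma>] anti[of \<gamma> g] g(1) l\<gamma> by (metis less_irrefl linorder_less_linear)
  qed
qed

section \<open>Weak duality for the transport constraint\<close>

lemma frob_inner_outer: "frob_inner (outer x) X = x \<bullet> (X *v x)"
  unfolding frob_inner_def outer_def trace_def transpose_def matrix_matrix_mult_def
    inner_vec_def matrix_vector_mult_def
  by (simp add: sum_distrib_left mult_ac) (subst sum.swap, simp add: mult.left_commute)

lemma psd_matrix_mult_transpose: "psd (A ** transpose A)" for A :: "real^'p^'p"
proof -
  have "x \<bullet> ((A ** transpose A) *v x) = (transpose A *v x) \<bullet> (transpose A *v x)" for x
    by (simp add: inner_matrix_vector_transpose matrix_vector_mul_assoc)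
  then show ?thesis by (simp add: psd_def matrix_transpose_mul)
qed

lemma pd_imp_psd: "pd A \<Longrightarrow> psd A"
  unfolding pd_def psd_def by (metis inner_zero_left less_eq_real_def)

text \<open>
The difference of the two sides is the square \<open>w \<bullet> (\<gamma> I - X) w\<close> at \<open>w = x - (I + A) y\<close>. The
hypothesis on \<open>A\<close> makes \<open>x = (I + A) y\<close> the critical point of the penalized objective in \<open>x\<close>.
\<close>
lemma quadratic_form_le_transport_penalty:
  fixes A X :: "real^'p^'p"
  assumes P: "psd (\<gamma> *\<^sub>R mat 1 - X)"
    and crit: "(\<gamma> *\<^sub>R mat 1 - X) ** (mat 1 + A) = \<gamma> *\<^sub>R mat 1"
  shows "x \<bullet> (X *v x) \<le> \<gamma> * (norm (x - y))\<^sup>2 + y \<bullet> ((\<gamma> *\<^sub>R A) *v y)"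
proof -
  let ?P = "\<gamma> *\<^sub>R mat 1 - X" and ?N = "mat 1 + A"
  let ?w = "x - ?N *v y"
  have symP: "u \<bullet> (?P *v w) = w \<bullet> (?P *v u)" for u w
    using P unfolding psd_def by (metis inner_matrix_vector_transpose inner_commute)
  have PN: "?P *v (?N *v y) = \<gamma> *\<^sub>R y"
    by (simp add: matrix_vector_mul_assoc crit scaleR_matrix_vector_assoc[symmetric])
  have "0 \<le> ?w \<bullet> (?P *v ?w)"
    using P unfolding psd_def by blast
  also have "\<dots> = x \<bullet> (?P *v x) - 2 * (x \<bullet> (?P *v (?N *v y))) + (?N *v y) \<bullet> (?P *v (?N *v y))"
    using symP[of "?N *v y" x]
    by (simp only: matrix_vector_mult_diff_distrib inner_diff_left inner_diff_right)
  also have "\<dots> = x \<bullet> (?P *v x) - 2 * \<gamma> * (x \<bullet> y) + \<gamma> * (y \<bullet> (?N *v y))"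
    unfolding PN by (simp add: inner_commute)
  also have "x \<bullet> (?P *v x) = \<gamma> * (x \<bullet> x) - x \<bullet> (X *v x)"
    by (simp add: matrix_vector_mult_diff_rdistrib scaleR_matrix_vector_assoc[symmetric] inner_diff_right)
  also have "y \<bullet> (?N *v y) = y \<bullet> (A *v y) + y \<bullet> y"
    by (simp add: matrix_vector_mult_add_rdistrib inner_add_right)
  finally show ?thesis
    by (simp add: power2_norm_eq_inner inner_diff_left inner_diff_right inner_commute[of y x]
        scaleR_matrix_vector_assoc[symmetric] algebra_simps)
qed

lemma borel_measurable_fst_snd [measurable]:
  shows "(fst :: 'a::topological_space \<times> 'b::topological_space \<Rightarrow> 'a) \<in> borel_measurable borel"
    and "(snd :: 'a \<times> 'b \<Rightarrow> 'b) \<in> borel_measurable borel"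
  by (intro borel_measurable_continuous_onI continuous_on_fst continuous_on_snd continuous_on_id)+

lemma borel_measurable_distance_square:
  "(\<lambda>z. (norm (fst z - snd z :: 'a::real_normed_vector))\<^sup>2) \<in> borel_measurable borel"
  by (intro borel_measurable_continuous_onI continuous_intros)

text \<open>Driving both laws by the same standard normal vector yields a coupling of explicit cost.\<close>
lemma gauss_law_coupling:
  fixes A B :: "real^'p^'p"
  defines "M \<equiv> distr std_normal_vec borel (\<lambda>z. (A *v z, B *v z))"
  shows "M \<in> couplings (gauss A) (gauss B)"
    and "(\<integral>z. (norm (fst z - snd z))\<^sup>2 \<partial>M) = trace ((A - B) ** transpose (A - B))"
proof -
  have m: "(\<lambda>z. (A *v z, B *v z)) \<in> measurable std_normal_vec borel"
    by measurable
  interpret prob_space "std_normal_vec :: (real^'p) measure" by (rule prob_space_std_normal_vec)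
  have "distr M borel fst = gauss A"
    unfolding M_def gauss_def
    by (subst distr_distr[OF borel_measurable_fst_snd(1) m]) (simp add: comp_def)
  moreover have "distr M borel snd = gauss B"
    unfolding M_def gauss_def
    by (subst distr_distr[OF borel_measurable_fst_snd(2) m]) (simp add: comp_def)
  ultimately show "M \<in> couplings (gauss A) (gauss B)"
    using prob_space_distr[OF m] by (simp add: couplings_def M_def)
  have "(\<integral>z. (norm (fst z - snd z))\<^sup>2 \<partial>M) = (\<integral>z. (norm (A *v z - B *v z))\<^sup>2 \<partial>std_normal_vec)"
    unfolding M_def by (subst integral_distr[OF m borel_measurable_distance_square]) simp
  also have "\<dots> = (\<integral>z. z \<bullet> ((transpose (A - B) ** (A - B)) *v z) \<partial>std_normal_vec)"
    by (simp add: power2_norm_eq_inner matrix_vector_mult_diff_rdistrib[symmetric]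
        inner_matrix_vector_transpose matrix_vector_mul_assoc)
  finally show "(\<integral>z. (norm (fst z - snd z))\<^sup>2 \<partial>M) = trace ((A - B) ** transpose (A - B))"
    by (simp add: std_normal_vec_quadratic_form trace_mul_sym[of "A - B"])
qed

lemma wasserstein2_le:
  assumes "M \<in> couplings P Q" and "(\<integral>z. (norm (fst z - snd z))\<^sup>2 \<partial>M) \<le> r\<^sup>2" and "r \<ge> 0"
  shows "wasserstein2 P Q \<le> r"
proof -
  have "wasserstein2 P Q \<le> sqrt (\<integral>z. (norm (fst z - snd z))\<^sup>2 \<partial>M)"
    unfolding wasserstein2_def
    by (intro cINF_lower assms bdd_belowI2[where m = 0]) simp
  also have "\<dots> \<le> r"
    using assms by (intro real_le_lsqrt) auto
  finally show ?thesis .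
qed

text \<open>
For an arbitrary coupling, functions of one coordinate are integrated through the marginals. The
transport cost is integrable because \<open>\<parallel>x - y\<parallel>\<^sup>2 \<le> 2 \<parallel>x\<parallel>\<^sup>2 + 2 \<parallel>y\<parallel>\<^sup>2\<close>.
\<close>
lemma gauss_coupling_marginal_quadratic_forms:
  fixes A B X :: "real^'p^'p"
  assumes M: "M \<in> couplings (gauss A) (gauss B)"
  shows "integrable M (\<lambda>z. fst z \<bullet> (X *v fst z))"
    and "(\<integral>z. fst z \<bullet> (X *v fst z) \<partial>M) = trace (X ** (A ** transpose A))"
    and "integrable M (\<lambda>z. snd z \<bullet> (X *v snd z))"
    and "(\<integral>z. snd z \<bullet> (X *v snd z) \<partial>M) = trace (X ** (B ** transpose B))"
    and "integrable M (\<lambda>z. (norm (fst z - snd z))\<^sup>2)"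
proof -
  have [measurable_cong]: "sets M = sets borel" and d: "gauss A = distr M borel fst" "gauss B = distr M borel snd"
    using M by (auto simp: couplings_def)
  have f: "fst \<in> measurable M borel" and s: "snd \<in> measurable M borel"
    by measurable
  have q: "(\<lambda>x. x \<bullet> (Y *v x)) \<in> borel_measurable borel" for Y :: "real^'p^'p" by measurable
  have i1: "integrable M (\<lambda>z. fst z \<bullet> (Y *v fst z))" for Y
    using gauss_quadratic_form(1)[of A Y] unfolding d integrable_distr_eq[OF f q] .
  have i2: "integrable M (\<lambda>z. snd z \<bullet> (Y *v snd z))" for Y
    using gauss_quadratic_form(1)[of B Y] unfolding d integrable_distr_eq[OF s q] .
  show "integrable M (\<lambda>z. fst z \<bullet> (X *v fst z))" "integrable M (\<lambda>z. snd z \<bullet> (X *v snd z))"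
    by (rule i1 i2)+
  show "(\<integral>z. fst z \<bullet> (X *v fst z) \<partial>M) = trace (X ** (A ** transpose A))"
    using gauss_quadratic_form(2)[of A X] unfolding d integral_distr[OF f q] .
  show "(\<integral>z. snd z \<bullet> (X *v snd z) \<partial>M) = trace (X ** (B ** transpose B))"
    using gauss_quadratic_form(2)[of B X] unfolding d integral_distr[OF s q] .
  show "integrable M (\<lambda>z. (norm (fst z - snd z))\<^sup>2)"
  proof (rule Bochner_Integration.integrable_bound)
    show "integrable M (\<lambda>z. 2 * (fst z \<bullet> (mat 1 *v fst z)) + 2 * (snd z \<bullet> (mat 1 *v snd z)))"
      by (intro Bochner_Integration.integrable_add integrable_mult_right i1 i2)
    show "(\<lambda>z. (norm (fst z - snd z))\<^sup>2) \<in> borel_measurable M"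
      using borel_measurable_distance_square[where 'a = "real^'p"]
      by (simp add: measurable_cong_sets[OF \<open>sets M = sets borel\<close> refl])
    show "AE z in M. norm ((norm (fst z - snd z))\<^sup>2) \<le> norm (2 * (fst z \<bullet> (mat 1 *v fst z)) + 2 * (snd z \<bullet> (mat 1 *v snd z)))"
    proof (rule AE_I2)
      fix z :: "(real^'p) \<times> (real^'p)"
      have "0 \<le> (fst z + snd z) \<bullet> (fst z + snd z)" by simp
      then have "(norm (fst z - snd z))\<^sup>2 \<le> 2 * (fst z \<bullet> fst z) + 2 * (snd z \<bullet> snd z)"
        unfolding power2_norm_eq_inner
        by (simp add: inner_diff_left inner_diff_right inner_add_left inner_add_right inner_commute)
      then show "norm ((norm (fst z - snd z))\<^sup>2) \<le> norm (2 * (fst z \<bullet> (mat 1 *v fst z)) + 2 * (snd z \<bullet> (mat 1 *v snd z)))"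
        by simp
    qed
  qed
qed

text \<open>
Weak duality: \<open>\<gamma>\<close> is a multiplier for the transport constraint and \<open>y \<bullet> D y\<close> a function of the
reference variable that dominates the penalized objective. Integrating the domination over a
coupling bounds the cost of every coupling from below, hence also the infimum.
\<close>
lemma gauss_quadratic_form_le_wasserstein2:
  fixes A B X D :: "real^'p^'p"
  assumes \<gamma>: "\<gamma> > 0"
    and dom: "\<And>x y. x \<bullet> (X *v x) \<le> \<gamma> * (norm (x - y))\<^sup>2 + y \<bullet> (D *v y)"
    and W: "wasserstein2 (gauss A) (gauss B) \<le> \<rho>"
  shows "trace (X ** (A ** transpose A)) \<le> \<gamma> * \<rho>\<^sup>2 + trace (D ** (B ** transpose B))"
proof -
  let ?v = "(trace (X ** (A ** transpose A)) - trace (D ** (B ** transpose B))) / \<gamma>"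
  have "sqrt ?v \<le> wasserstein2 (gauss A) (gauss B)"
    unfolding wasserstein2_def
  proof (rule cINF_greatest)
    show "couplings (gauss A) (gauss B) \<noteq> {}" using gauss_law_coupling(1) by blast
    fix M assume M: "M \<in> couplings (gauss A) (gauss B)"
    note q = gauss_coupling_marginal_quadratic_forms[OF M]
    have "(\<integral>z. fst z \<bullet> (X *v fst z) \<partial>M) \<le> (\<integral>z. \<gamma> * (norm (fst z - snd z))\<^sup>2 + snd z \<bullet> (D *v snd z) \<partial>M)"
      by (intro integral_mono dom Bochner_Integration.integrable_add integrable_mult_right q)
    also have "\<dots> = \<gamma> * (\<integral>z. (norm (fst z - snd z))\<^sup>2 \<partial>M) + trace (D ** (B ** transpose B))"
      by (simp add: q)
    finally show "sqrt ?v \<le> sqrt (\<integral>z. (norm (fst z - snd z))\<^sup>2 \<partial>M)"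
      using \<gamma> by (simp add: q divide_le_eq mult.commute)
  qed
  with W have "sqrt ?v \<le> \<rho>" by simp
  then have "?v \<le> \<rho>\<^sup>2" by (rule sqrt_le_D)
  then show ?thesis using \<gamma> by (simp add: divide_le_eq mult.commute)
qed

section \<open>The worst-case normal law\<close>

theorem theorem5p1:
  fixes \<rho> :: real and \<Sigma>h X :: "real^'p^'p"
  assumes "\<rho> > 0" and "pd \<Sigma>h" and "pd X"
  shows "\<exists>\<gamma>::real.
    (\<forall>g. (g *\<^sub>R mat 1 \<succ>\<^sub>L X \<and>
          \<rho>\<^sup>2 - trace \<Sigma>h
            + 2 * g * trace (matrix_inv (g *\<^sub>R mat 1 - X) ** \<Sigma>h)
            - g\<^sup>2 * trace (matrix_inv (g *\<^sub>R mat 1 - X) ** \<Sigma>h ** matrix_inv (g *\<^sub>R mat 1 - X)) = 0)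
         \<longleftrightarrow> g = \<gamma>) \<and>
    (let S = \<gamma>\<^sup>2 *\<^sub>R (matrix_inv (\<gamma> *\<^sub>R mat 1 - X) ** \<Sigma>h ** matrix_inv (\<gamma> *\<^sub>R mat 1 - X))
     in psd S \<and> normal0 S \<in> ambiguity \<rho> \<Sigma>h \<and>
        (SUP Q\<in>ambiguity \<rho> \<Sigma>h. ereal (\<integral>\<xi>. frob_inner (outer \<xi>) X \<partial>Q))
          = ereal (\<integral>\<xi>. frob_inner (outer \<xi>) X \<partial>(normal0 S)))"
proof -
  obtain U :: "real^'p^'p" and l where U: "orthogonal_matrix U" and X: "X = U ** diag_matrix l ** transpose U"
    using spectral_theorem_symmetric assms(3) unfolding pd_def by metis
  have l: "l i > 0" for i using assms(3) pd_diag_conj_iff[OF U] X by auto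
  obtain B :: "real^'p^'p" where B: "invertible B" "\<Sigma>h = B ** transpose B"
    using pd_factorization[OF assms(2)] .
  define R where "R g = matrix_inv (g *\<^sub>R mat 1 - X)" for g
  define E where "E g = g *\<^sub>R R g - mat 1" for g
  define c where "c i = column i U \<bullet> (\<Sigma>h *v column i U)" for i
  have gt: "g *\<^sub>R mat 1 \<succ>\<^sub>L X \<longleftrightarrow> (\<forall>i. l i < g)" for g
  proof -
    have "g *\<^sub>R mat 1 - X = U ** diag_matrix (\<lambda>i. g - l i) ** transpose U"
      unfolding diag_conj_one[OF U, symmetric] X diag_conj_scaleR diag_conj_diff by simp
    then show ?thesis by (simp add: loewner_gt_def pd_diag_conj_iff[OF U])
  qed
  have inv: "(g *\<^sub>R mat 1 - X) ** R g = mat 1"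
    and R: "R g = U ** diag_matrix (\<lambda>i. 1 / (g - l i)) ** transpose U" if "\<forall>i. l i < g" for g
  proof -
    have "l i \<noteq> g" for i using that by (metis less_irrefl)
    then have *: "(g *\<^sub>R mat 1 - X) ** (U ** diag_matrix (\<lambda>i. 1 / (g - l i)) ** transpose U) = mat 1"
      unfolding X by (rule resolvent_diag_conj[OF U])
    then show "R g = U ** diag_matrix (\<lambda>i. 1 / (g - l i)) ** transpose U"
      unfolding R_def by (rule matrix_inv_eqI)
    with * show "(g *\<^sub>R mat 1 - X) ** R g = mat 1" by simp
  qed
  have E: "E g = U ** diag_matrix (\<lambda>i. l i / (g - l i)) ** transpose U" if "\<forall>i. l i < g" for g
  proof -
    have "g * (1 / (g - l i)) - 1 = l i / (g - l i)" for i
      using spec[OF that, of i] by (simp add: field_simps)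
    then show ?thesis
      unfolding E_def R[OF that] diag_conj_one[OF U, symmetric] diag_conj_scaleR diag_conj_diff by simp
  qed
  have c: "c i > 0" for i
  proof -
    have "column i U \<noteq> 0"
      using U unfolding orthogonal_matrix_orthonormal_columns by (metis norm_zero zero_neq_one)
    then show ?thesis using assms(2) by (simp add: pd_def c_def)
  qed
  have traceE: "trace (E g ** \<Sigma>h ** E g) = (\<Sum>i\<in>UNIV. (l i / (g - l i))\<^sup>2 * c i)" if "\<forall>i. l i < g" for g
    unfolding E[OF that] trace_diag_conj_sandwich[OF U] c_def ..
  have constraint: "\<rho>\<^sup>2 - trace \<Sigma>h + 2 * g * trace (R g ** \<Sigma>h) - g\<^sup>2 * trace (R g ** \<Sigma>h ** R g)
      = \<rho>\<^sup>2 - trace (E g ** \<Sigma>h ** E g)" for g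
    unfolding E_def trace_resolvent_displacement by simp
  obtain \<gamma> where \<gamma>: "\<And>i. l i < \<gamma>" "(\<Sum>i\<in>UNIV. (l i / (\<gamma> - l i))\<^sup>2 * c i) = \<rho>\<^sup>2"
    "\<And>g. (\<forall>i. l i < g) \<Longrightarrow> (\<Sum>i\<in>UNIV. (l i / (g - l i))\<^sup>2 * c i) = \<rho>\<^sup>2 \<Longrightarrow> g = \<gamma>"
    using secular_equation_unique_root[of l c \<rho>] l c assms(1) by blast
  have \<gamma>l: "\<forall>i. l i < \<gamma>" using \<gamma>(1) by blast
  have root: "(g *\<^sub>R mat 1 \<succ>\<^sub>L X \<and>
      \<rho>\<^sup>2 - trace \<Sigma>h + 2 * g * trace (R g ** \<Sigma>h) - g\<^sup>2 * trace (R g ** \<Sigma>h ** R g) = 0) \<longleftrightarrow> g = \<gamma>" for g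
    unfolding constraint gt using \<gamma> traceE[of g] by auto
  have pos: "\<gamma> > 0" using l \<gamma>(1) less_trans by blast

  \<comment> \<open>\<open>N\<close> is the optimal transport map from \<open>N(0, \<Sigma>h)\<close> and \<open>A\<close> its displacement.\<close>
  define A where "A = E \<gamma>"
  define N where "N = \<gamma> *\<^sub>R R \<gamma>"
  have N: "N = mat 1 + A" by (simp add: A_def N_def E_def)
  have crit: "(\<gamma> *\<^sub>R mat 1 - X) ** N = \<gamma> *\<^sub>R mat 1"
    using inv[OF \<gamma>l] by (simp add: N_def matrix_scalar_ac scalar_matrix_assoc[symmetric])
  have symN: "transpose N = N"
    by (simp add: N_def transpose_scalar R[OF \<gamma>l] transpose_diag_conj)
  have symA: "transpose A = A" unfolding A_def E[OF \<gamma>l] by (rule transpose_diag_conj)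
  have cost: "trace (A ** \<Sigma>h ** A) = \<rho>\<^sup>2"
    using traceE[OF \<gamma>l] \<gamma>(2) by (simp add: A_def)
  define S where "S = \<gamma>\<^sup>2 *\<^sub>R (R \<gamma> ** \<Sigma>h ** R \<gamma>)"
  have SN: "S = N ** \<Sigma>h ** N"
    by (simp add: S_def N_def matrix_scalar_ac scalar_matrix_assoc[symmetric] power2_eq_square)
  have S: "S = (N ** B) ** transpose (N ** B)"
    unfolding SN B(2) by (simp add: matrix_transpose_mul symN matrix_mul_assoc)
  have invN: "invertible N"
  proof -
    have "((1 / \<gamma>) *\<^sub>R (\<gamma> *\<^sub>R mat 1 - X)) ** N = mat 1"
      using crit pos by (simp add: scalar_matrix_assoc[symmetric])
    then show ?thesis by (auto simp: invertible_left_inverse)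
  qed
  have normS: "normal0 S = gauss (N ** B)"
    unfolding S using invN B(1) by (intro normal0_eq_gauss invertible_mult)
  have norm\<Sigma>: "normal0 \<Sigma>h = gauss B"
    unfolding B(2) by (rule normal0_eq_gauss[OF B(1)])

  \<comment> \<open>Feasibility: the coupling \<open>(N B Z, B Z)\<close> has cost exactly \<open>\<rho>\<^sup>2\<close>.\<close>
  have "trace ((N ** B - B) ** transpose (N ** B - B)) = \<rho>\<^sup>2"
  proof -
    have "A = N - mat 1" by (simp add: N)
    then have "N ** B - B = A ** B" by (simp add: matrix_diff_rdistrib)
    then have "(N ** B - B) ** transpose (N ** B - B) = A ** \<Sigma>h ** A"
      by (simp add: B(2) matrix_transpose_mul symA matrix_mul_assoc)
    then show ?thesis by (simp add: cost)
  qed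
  then have W: "wasserstein2 (gauss (N ** B)) (gauss B) \<le> \<rho>"
    using assms(1) gauss_law_coupling(2)[of "N ** B" B]
    by (intro wasserstein2_le[OF gauss_law_coupling(1)]) auto
  have psdS: "psd S" unfolding S by (rule psd_matrix_mult_transpose)
  then have "normal0 S \<in> normal0_family" by (auto simp: normal0_family_def)
  then have mem: "normal0 S \<in> ambiguity \<rho> \<Sigma>h"
    using W by (simp add: ambiguity_def normS norm\<Sigma>)

  have expect: "(\<integral>\<xi>. frob_inner (outer \<xi>) X \<partial>gauss C) = trace (X ** (C ** transpose C))" for C
    by (simp add: frob_inner_outer gauss_quadratic_form)
  have "psd (\<gamma> *\<^sub>R mat 1 - X)"
    using gt \<gamma>l unfolding loewner_gt_def by (blast intro: pd_imp_psd)
  then have dom: "x \<bullet> (X *v x) \<le> \<gamma> * (norm (x - y))\<^sup>2 + y \<bullet> ((\<gamma> *\<^sub>R A) *v y)" for x y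
    using crit unfolding N by (rule quadratic_form_le_transport_penalty)
  \<comment> \<open>The dual bound is attained: \<open>X N = \<gamma> A\<close>, and \<open>N = I + A\<close> splits the objective into
    transport cost and dominating function.\<close>
  have opt: "trace (X ** S) = \<gamma> * \<rho>\<^sup>2 + trace ((\<gamma> *\<^sub>R A) ** \<Sigma>h)"
  proof -
    have "X ** N = \<gamma> *\<^sub>R A"
      using crit by (simp add: matrix_diff_rdistrib scalar_matrix_assoc[symmetric] N algebra_simps)
    then have "X ** S = (\<gamma> *\<^sub>R A) ** \<Sigma>h ** (mat 1 + A)"
      unfolding SN by (simp add: matrix_mul_assoc N)
    also have "\<dots> = (\<gamma> *\<^sub>R A) ** \<Sigma>h + \<gamma> *\<^sub>R (A ** \<Sigma>h ** A)"
      by (simp add: matrix_add_ldistrib scalar_matrix_assoc[symmetric])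
    finally show ?thesis by (simp add: trace_add trace_scaleR cost)
  qed
  have "(SUP Q\<in>ambiguity \<rho> \<Sigma>h. ereal (\<integral>\<xi>. frob_inner (outer \<xi>) X \<partial>Q))
      = ereal (\<integral>\<xi>. frob_inner (outer \<xi>) X \<partial>(normal0 S))"
  proof (rule antisym)
    show "(SUP Q\<in>ambiguity \<rho> \<Sigma>h. ereal (\<integral>\<xi>. frob_inner (outer \<xi>) X \<partial>Q))
        \<le> ereal (\<integral>\<xi>. frob_inner (outer \<xi>) X \<partial>(normal0 S))"
    proof (rule SUP_least)
      fix Q assume "Q \<in> ambiguity \<rho> \<Sigma>h"
      \<comment> \<open>\<open>Q\<close> may be degenerate. Whichever factor \<open>C\<close> of its covariance is selected by choice, the dual
        bound applies to the image of the standard normal law under \<open>C\<close>.\<close>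
      then obtain C where Q: "Q = gauss C" and W: "wasserstein2 (gauss C) (gauss B) \<le> \<rho>"
        by (auto simp: ambiguity_def normal0_family_def norm\<Sigma>) (auto simp: normal0_def gauss_def)
      have "(\<integral>\<xi>. frob_inner (outer \<xi>) X \<partial>Q) \<le> \<gamma> * \<rho>\<^sup>2 + trace ((\<gamma> *\<^sub>R A) ** \<Sigma>h)"
        unfolding Q expect B(2) by (rule gauss_quadratic_form_le_wasserstein2[OF pos dom W])
      also have "\<dots> = (\<integral>\<xi>. frob_inner (outer \<xi>) X \<partial>(normal0 S))"
        unfolding normS expect by (simp only: opt[symmetric] S)
      finally show "ereal (\<integral>\<xi>. frob_inner (outer \<xi>) X \<partial>Q) \<le> ereal (\<integral>\<xi>. frob_inner (outer \<xi>) X \<partial>(normal0 S))"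
        by simp
    qed
  qed (rule SUP_upper[OF mem])
  with root psdS mem show ?thesis
    unfolding R_def S_def Let_def by (intro exI[of _ \<gamma>] conjI allI)
qed

end
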